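(* Let $k\geq3$ and $l=\left\lceil\frac{\sqrt{2k-1}-1}{2}\right\rceil$. For splittable and for unit-demand $k$-CVRP, the AG-ITP algorithm applied to the Christofides–Serdyukov Hamiltonian cycle $H_{CS}$ has approximation ratio $\frac{5}{2}-\frac{2l^2+k+l-1}{2kl}$, and this quantity is strictly smaller than $\frac{5}{2}-\sqrt{2/k}$.
   Context: An instance of CVRP consists of a complete graph $G$ on vertex set $V\cup\{v_0\}$, where $V=\{v_1,\dots,v_n\}$ are customers and $v_0$ is the depot; a nonnegative edge weight $w$ that is symmetric and satisfies the triangle inequality; a demand $d_i\in\mathbb{Z}_{\geq1}$ for each customer; and a capacity $k$. A tour is a closed walk starting and ending at $v_0$ delivering a total of at most $k$; a feasible solution is a collection of tours meeting all demands, with cost equal to the total weight of traversed edges. In unit-demand CVRP all $d_i=1$; in splittable CVRP a demand may be split among several tours, and an instance is treated as a unit-demand instance by replacing each customer of demand $d_i$ by $d_i$ unit-demand customers at the same location. The Christofides–Serdyukov cycle $H_{CS}$ on $V\cup\{v_0\}$ is obtained by computing a minimum spanning tree $T$ of $G$, a minimum-weight perfect matching $M$ on the odd-degree vertices of $T$, an Euler tour of $T\cup M$, and shortcutting repeated vertices. The AG-ITP algorithm, given a Hamiltonian cycle $H=(v_0,u_1,u_2,\dots,u_n,v_0)$ on the depot and the (unit-demand) customers, considers for each $i\in\{1,\dots,k\}$ the solution consisting of the tour $(v_0,u_1,\dots,u_i,v_0)$ followed by tours $(v_0,u_{i+1},\dots,u_{i+k},v_0)$, $(v_0,u_{i+k+1},\dots,u_{i+2k},v_0)$,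 and so on (the last tour taking the remaining customers up to $u_n$), and outputs the cheapest of these $k$ solutions. The approximation ratio is the worst-case ratio of the output cost to the optimum cost. *)

theory Defs
  imports Complex_Main "HOL-Library.Multiset" "HOL-Library.Sublist"
begin

subsection \<open>Instances, solutions and the optimum\<close>

text \<open>Triples of arbitrary vertices include repeated ones; \<open>w u u = 0\<close> is the usual
  convention that staying in place is free, and it puts the unit copies of one customer
  (see below) at distance \<open>0\<close> from each other.\<close>

definition cvrp_instance ::
  "'v set \<Rightarrow> 'v \<Rightarrow> ('v \<Rightarrow> 'v \<Rightarrow> real) \<Rightarrow> ('v \<Rightarrow> nat) \<Rightarrow> bool" where
  "cvrp_instance V v0 w d \<longleftrightarrow>
     finite V \<and> v0 \<notin> V \<and>
     (\<forall>u \<in> insert v0 V. w u u = 0) \<and>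
     (\<forall>u \<in> insert v0 V. \<forall>v \<in> insert v0 V. 0 \<le> w u v \<and> w u v = w v u) \<and>
     (\<forall>u \<in> insert v0 V. \<forall>v \<in> insert v0 V. \<forall>x \<in> insert v0 V. w u x \<le> w u v + w v x) \<and>
     (\<forall>v \<in> V. 1 \<le> d v)"

definition walk_weight :: "('v \<Rightarrow> 'v \<Rightarrow> real) \<Rightarrow> 'v list \<Rightarrow> real" where
  "walk_weight w p = sum_list (map2 w p (tl p))"

text \<open>A tour is a closed walk through the depot together with the amount it delivers to
  each customer. Deliveries are integral, as the demands are.\<close>

type_synonym 'v tour = "'v list \<times> ('v \<Rightarrow> nat)"

definition is_tour :: "'v set \<Rightarrow> 'v \<Rightarrow> nat \<Rightarrow> 'v tour \<Rightarrow> bool" where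
  "is_tour V v0 k t \<longleftrightarrow> (case t of (p, a) \<Rightarrow>
     p \<noteq> [] \<and> hd p = v0 \<and> last p = v0 \<and> set p \<subseteq> insert v0 V \<and>
     (\<forall>v \<in> V. 0 < a v \<longrightarrow> v \<in> set p) \<and>
     (\<Sum>v\<in>V. a v) \<le> k)"

definition feasible_solution ::
  "'v set \<Rightarrow> 'v \<Rightarrow> ('v \<Rightarrow> nat) \<Rightarrow> nat \<Rightarrow> 'v tour list \<Rightarrow> bool" where
  "feasible_solution V v0 d k S \<longleftrightarrow>
     (\<forall>t \<in> set S. is_tour V v0 k t) \<and>
     (\<forall>v \<in> V. (\<Sum>(p, a) \<leftarrow> S. a v) = d v)"

definition solution_cost :: "('v \<Rightarrow> 'v \<Rightarrow> real) \<Rightarrow> 'v tour list \<Rightarrow> real" where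
  "solution_cost w S = (\<Sum>(p, a) \<leftarrow> S. walk_weight w p)"

definition opt_cost ::
  "'v set \<Rightarrow> 'v \<Rightarrow> ('v \<Rightarrow> 'v \<Rightarrow> real) \<Rightarrow> ('v \<Rightarrow> nat) \<Rightarrow> nat \<Rightarrow> real" where
  "opt_cost V v0 w d k = (INF S \<in> {S. feasible_solution V v0 d k S}. solution_cost w S)"

subsection \<open>Reduction of splittable demands to unit demands\<close>

text \<open>Customer \<open>v\<close> becomes the co-located customers \<open>(v, 0), \<dots>, (v, d v - 1)\<close>;
  the depot of the expanded instance is \<open>(v0, 0)\<close>.\<close>

definition unit_customers :: "'v set \<Rightarrow> ('v \<Rightarrow> nat) \<Rightarrow> ('v \<times> nat) set" where
  "unit_customers V d = (SIGMA v:V. {..<d v})"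

definition unit_weight :: "('v \<Rightarrow> 'v \<Rightarrow> real) \<Rightarrow> 'v \<times> nat \<Rightarrow> 'v \<times> nat \<Rightarrow> real" where
  "unit_weight w x y = w (fst x) (fst y)"

subsection \<open>The Christofides--Serdyukov cycle\<close>

text \<open>Edges of the complete graph on \<open>U\<close> are two-element subsets of \<open>U\<close>.\<close>

definition complete_edges :: "'v set \<Rightarrow> 'v set set" where
  "complete_edges U = {{u, v} | u v. u \<in> U \<and> v \<in> U \<and> u \<noteq> v}"

definition edge_weight :: "('v \<Rightarrow> 'v \<Rightarrow> real) \<Rightarrow> 'v set \<Rightarrow> real" where
  "edge_weight w e = (THE r. \<exists>u v. e = {u, v} \<and> r = w u v)"
  \<comment> \<open>well defined on \<open>complete_edges U\<close> when \<open>w\<close> is symmetric on \<open>U\<close>\<close>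

definition edges_weight :: "('v \<Rightarrow> 'v \<Rightarrow> real) \<Rightarrow> 'v set set \<Rightarrow> real" where
  "edges_weight w E = (\<Sum>e\<in>E. edge_weight w e)"

definition walk_edges :: "'v list \<Rightarrow> 'v set list" where
  "walk_edges p = map2 (\<lambda>u v. {u, v}) p (tl p)"

definition connected_on :: "'v set \<Rightarrow> 'v set set \<Rightarrow> bool" where
  "connected_on U E \<longleftrightarrow> (\<forall>u \<in> U. \<forall>v \<in> U. \<exists>p. p \<noteq> [] \<and> hd p = u \<and> last p = v \<and>
     set p \<subseteq> U \<and> set (walk_edges p) \<subseteq> E)"

definition has_cycle :: "'v set set \<Rightarrow> bool" where
  "has_cycle E \<longleftrightarrow> (\<exists>c. 3 \<le> length c \<and> distinct c \<and> set (walk_edges (c @ [hd c])) \<subseteq> E)"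

definition spanning_tree :: "'v set \<Rightarrow> 'v set set \<Rightarrow> bool" where
  "spanning_tree U T \<longleftrightarrow> T \<subseteq> complete_edges U \<and> connected_on U T \<and> \<not> has_cycle T"

definition minimum_spanning_tree ::
  "'v set \<Rightarrow> ('v \<Rightarrow> 'v \<Rightarrow> real) \<Rightarrow> 'v set set \<Rightarrow> bool" where
  "minimum_spanning_tree U w T \<longleftrightarrow> spanning_tree U T \<and>
     (\<forall>T'. spanning_tree U T' \<longrightarrow> edges_weight w T \<le> edges_weight w T')"

definition odd_vertices :: "'v set \<Rightarrow> 'v set set \<Rightarrow> 'v set" where
  "odd_vertices U T = {v \<in> U. odd (card {e \<in> T. v \<in> e})}"

definition perfect_matching :: "'v set \<Rightarrow> 'v set set \<Rightarrow> bool" where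
  "perfect_matching W M \<longleftrightarrow> M \<subseteq> complete_edges W \<and> (\<forall>v \<in> W. \<exists>!e. e \<in> M \<and> v \<in> e)"

definition minimum_perfect_matching ::
  "'v set \<Rightarrow> ('v \<Rightarrow> 'v \<Rightarrow> real) \<Rightarrow> 'v set set \<Rightarrow> bool" where
  "minimum_perfect_matching W w M \<longleftrightarrow> perfect_matching W M \<and>
     (\<forall>M'. perfect_matching W M' \<longrightarrow> edges_weight w M \<le> edges_weight w M')"

text \<open>An edge lying in both the tree and the matching occurs twice in their union, which is
  therefore a multiset.\<close>

definition euler_tour :: "'v set \<Rightarrow> 'v set multiset \<Rightarrow> 'v list \<Rightarrow> bool" where
  "euler_tour U E p \<longleftrightarrow> p \<noteq> [] \<and> hd p = last p \<and> set p \<subseteq> U \<and> mset (walk_edges p) = E"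

text \<open>\<open>christofides_cycle V v0 w us\<close>: the Hamiltonian cycle \<open>(v0, us, v0)\<close> is a possible
  outcome of the construction. All ties and all choices of the Euler tour are allowed, and
  shortcutting may keep any one occurrence of each vertex. As a closed walk may be rotated,
  it is no restriction that the Euler tour starts at the depot.\<close>

definition christofides_cycle ::
  "'v set \<Rightarrow> 'v \<Rightarrow> ('v \<Rightarrow> 'v \<Rightarrow> real) \<Rightarrow> 'v list \<Rightarrow> bool" where
  "christofides_cycle V v0 w us \<longleftrightarrow> (let U = insert v0 V in
     \<exists>T M p. minimum_spanning_tree U w T \<and>
       minimum_perfect_matching (odd_vertices U T) w M \<and>
       euler_tour U (mset_set T + mset_set M) p \<and> hd p = v0 \<and>
       distinct (v0 # us) \<and> set (v0 # us) = U \<and> subseq (v0 # us) p)"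

subsection \<open>AG-ITP\<close>

function blocks :: "nat \<Rightarrow> 'v list \<Rightarrow> 'v list list" where
  "blocks k us = (if k = 0 \<or> us = [] then [] else take k us # blocks k (drop k us))"
  by pat_completeness auto
termination
  by (relation "measure (\<lambda>(k, us). length us)") auto

declare blocks.simps [simp del]

definition itp_cost :: "'v \<Rightarrow> ('v \<Rightarrow> 'v \<Rightarrow> real) \<Rightarrow> nat \<Rightarrow> 'v list \<Rightarrow> nat \<Rightarrow> real" where
  "itp_cost v0 w k us i =
     (\<Sum>b \<leftarrow> take i us # blocks k (drop i us). walk_weight w (v0 # b @ [v0]))"

definition agitp_cost :: "'v \<Rightarrow> ('v \<Rightarrow> 'v \<Rightarrow> real) \<Rightarrow> nat \<Rightarrow> 'v list \<Rightarrow> real" where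
  "agitp_cost v0 w k us = (MIN i \<in> {1..k}. itp_cost v0 w k us i)"

end

theory Submission
  imports Defs
begin

text \<open>Each edge of the Hamiltonian cycle \<open>H\<close> between two customers is cut in exactly one of the \<open>k\<close>
  solutions, so these cost \<open>(k - 1) w(H) + 2 \<Sum> w(v0, u)\<close> in total. Euler tour and shortcutting
  give \<open>w(H) \<le> w(T) + w(M)\<close>. Fix tours serving the unit customers, of lengths \<open>c\<close> with longest
  edges \<open>m\<close>. Deleting the longest edge of every tour leaves a spanning tree, so
  \<open>w(T) \<le> \<Sum> (c - m)\<close>, and the two alternating matchings on the odd vertices, taken in the order
  of the tours, give \<open>w(M) \<le> \<Sum> c / 2\<close>. The distances from the depot along a single tour sum to
  at most \<open>j (j + 1) m + (k - 2 j) c / 2\<close> for every \<open>j \<le> k / 2\<close>; a convex combination of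
  \<open>j = l - 1\<close> and \<open>j = l\<close> eliminates \<open>m\<close> and leaves the ratio. The ratio is below
  \<open>5 / 2 - sqrt (2 / k)\<close> because, with \<open>s = sqrt (2 k)\<close>, the quadratic
  \<open>2 l\<^sup>2 + (1 - 2 s) l + s\<^sup>2 / 2 - 1\<close> in \<open>l\<close> has discriminant \<open>9 - 4 s < 0\<close>.\<close>

section \<open>Weights of walks, shortcutting and Euler tours\<close>

lemma walk_weight_Nil [simp]: "walk_weight w [] = 0"
  and walk_weight_single [simp]: "walk_weight w [x] = 0"
  and walk_weight_Cons_Cons [simp]:
    "walk_weight w (x # y # zs) = w x y + walk_weight w (y # zs)"
  by (simp_all add: walk_weight_def)

lemma walk_weight_Cons:
  "xs \<noteq> [] \<Longrightarrow> walk_weight w (x # xs) = w x (hd xs) + walk_weight w xs"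
  by (cases xs) auto

lemma walk_weight_append:
  assumes "xs \<noteq> []" "ys \<noteq> []"
  shows "walk_weight w (xs @ ys) = walk_weight w xs + w (last xs) (hd ys) + walk_weight w ys"
  using assms by (induction xs rule: induct_list012) (auto simp: walk_weight_Cons)

lemma walk_weight_map:
  "walk_weight w (map f xs) = walk_weight (\<lambda>x y. w (f x) (f y)) xs"
  by (induction xs rule: induct_list012) auto

text \<open>Distance \<open>0\<close> between distinct points is allowed, because the unit copies of
  one customer coincide. The axioms are relative to \<open>U\<close>, as an instance constrains
  \<open>w\<close> on depot and customers only.\<close>

locale semimetric =
  fixes U :: "'a set" and w :: "'a \<Rightarrow> 'a \<Rightarrow> real"
  assumes refl0: "u \<in> U \<Longrightarrow> w u u = 0"
    and nonneg: "u \<in> U \<Longrightarrow> v \<in> U \<Longrightarrow> 0 \<le> w u v"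
    and sym: "u \<in> U \<Longrightarrow> v \<in> U \<Longrightarrow> w u v = w v u"
    and tri: "u \<in> U \<Longrightarrow> v \<in> U \<Longrightarrow> x \<in> U \<Longrightarrow> w u x \<le> w u v + w v x"
begin

lemma walk_weight_nonneg: "set xs \<subseteq> U \<Longrightarrow> 0 \<le> walk_weight w xs"
  by (induction xs rule: induct_list012) (auto intro!: add_nonneg_nonneg nonneg)

lemma walk_weight_rev: "set xs \<subseteq> U \<Longrightarrow> walk_weight w (rev xs) = walk_weight w xs"
proof (induction xs rule: induct_list012)
  case (3 x y zs)
  have "walk_weight w (rev (x # y # zs)) = walk_weight w (rev (y # zs) @ [x])"
    by simp
  also have "\<dots> = walk_weight w (rev (y # zs)) + w y x"
    by (subst walk_weight_append) (auto simp: last_rev)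
  finally show ?case using 3 sym[of x y] by simp
qed auto

lemma walk_weight_insert_le:
  assumes "a \<in> U" "y \<in> U" "set zs \<subseteq> U" "zs \<noteq> []"
  shows "walk_weight w (a # zs) \<le> walk_weight w (a # y # zs)"
  using assms tri[of a y "hd zs"] by (cases zs) auto

text \<open>Induction on the embedding: each skipped vertex costs one triangle inequality. The start
  \<open>a\<close> is generalised because it moves along the walk.\<close>

lemma walk_weight_shortcut:
  assumes "subseq xs ys" "a \<in> U" "b \<in> U" "set ys \<subseteq> U"
  shows "walk_weight w (a # xs @ [b]) \<le> walk_weight w (a # ys @ [b])"
  using assms
proof (induction arbitrary: a)
  case (list_emb_Nil ys)
  then show ?case
  proof (induction ys arbitrary: a)
    case (Cons y ys)
    then have "walk_weight w (a # [] @ [b]) \<le> w a y + walk_weight w (y # [] @ [b])"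
      using tri[of a y b] by simp
    also have "\<dots> \<le> w a y + walk_weight w (y # ys @ [b])"
      using Cons by (intro add_left_mono) auto
    finally show ?case by simp
  qed auto
next
  case (list_emb_Cons xs ys y)
  have "set xs \<subseteq> set ys"
    using list_emb_Cons.hyps by (metis subseq_conv_nths set_nths_subset)
  with list_emb_Cons.prems have "set xs \<subseteq> U" by auto
  then have "walk_weight w (a # xs @ [b]) \<le> walk_weight w (a # y # xs @ [b])"
    using list_emb_Cons.prems by (intro walk_weight_insert_le) auto
  also have "\<dots> \<le> walk_weight w (a # y # ys @ [b])"
    using list_emb_Cons by simp
  finally show ?case by simp
qed auto

lemma closed_walk_le:
  assumes "set Z \<subseteq> U" "r \<in> U" "Z \<noteq> []"
  shows "walk_weight w (Z @ [hd Z]) \<le> walk_weight w (r # Z @ [r])"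
proof -
  have "walk_weight w (r # Z @ [r]) = w r (hd Z) + walk_weight w Z + w (last Z) r"
    using assms by (simp add: walk_weight_Cons walk_weight_append)
  moreover have "walk_weight w (Z @ [hd Z]) = walk_weight w Z + w (last Z) (hd Z)"
    using assms by (simp add: walk_weight_append)
  moreover have "w (last Z) (hd Z) \<le> w (last Z) r + w r (hd Z)"
    using assms by (intro tri) (auto simp: subset_iff)
  ultimately show ?thesis by simp
qed

text \<open>Run the tours one after another and shortcut the intermediate returns to
  \<open>r\<close>.\<close>

lemma walk_weight_concat_le:
  assumes "r \<in> U" "\<And>X. X \<in> set Xs \<Longrightarrow> set X \<subseteq> U"
  shows "walk_weight w (r # concat Xs @ [r]) \<le> (\<Sum>X\<leftarrow>Xs. walk_weight w (r # X @ [r]))"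
  using assms(2)
proof (induction Xs)
  case Nil
  then show ?case using assms refl0 by simp
next
  case (Cons X Xs)
  have "walk_weight w (r # concat (X # Xs) @ [r]) \<le> walk_weight w (r # (X @ [r] @ concat Xs) @ [r])"
    using assms(1) Cons.prems
    by (intro walk_weight_shortcut) (auto intro: list_emb_append_mono subseq_order.refl list_emb_Cons)
  also have "\<dots> = walk_weight w ((r # X) @ (r # concat Xs @ [r]))" by simp
  also have "\<dots> = walk_weight w (r # X @ [r]) + walk_weight w (r # concat Xs @ [r])"
    using walk_weight_append[of "r # X" "r # concat Xs @ [r]" w]
      walk_weight_append[of "r # X" "[r]" w] by simp
  finally show ?case using Cons by fastforce
qed

text \<open>Repeating a vertex is free, but \<open>n v\<close> may be \<open>0\<close>, which drops
  \<open>v\<close>; hence an inequality and not an equation.\<close>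

lemma walk_weight_replicate_le:
  assumes "set vs \<subseteq> U" "a \<in> U" "b \<in> U"
  shows "walk_weight w (a # concat (map (\<lambda>v. replicate (n v) v) vs) @ [b]) \<le> walk_weight w (a # vs @ [b])"
  using assms
proof (induction vs arbitrary: a)
  case (Cons v vs)
  let ?R = "concat (map (\<lambda>v. replicate (n v) v) vs)"
  have sub: "set ?R \<subseteq> U" using Cons.prems by auto
  have stay: "walk_weight w (v # replicate m v @ ?R @ [b]) = walk_weight w (v # ?R @ [b])" for m
    using refl0[of v] Cons.prems by (induction m) auto
  have "walk_weight w (a # concat (map (\<lambda>v. replicate (n v) v) (v # vs)) @ [b])
      \<le> walk_weight w (a # v # replicate (n v) v @ ?R @ [b])"
    using walk_weight_insert_le[of a v "replicate (n v) v @ ?R @ [b]"] sub Cons.prems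
    by (simp add: set_replicate_conv_if)
  also have "\<dots> = w a v + walk_weight w (v # ?R @ [b])"
    by (simp add: stay)
  also have "\<dots> \<le> w a v + walk_weight w (v # vs @ [b])"
    using Cons by simp
  finally show ?case by simp
qed auto

lemma edge_weight_pair:
  assumes "u \<in> U" "v \<in> U"
  shows "edge_weight w {u, v} = w u v"
  unfolding edge_weight_def
proof (rule the_equality)
  show "\<exists>u' v'. {u, v} = {u', v'} \<and> w u v = w u' v'" by blast
  show "r = w u v" if "\<exists>u' v'. {u, v} = {u', v'} \<and> r = w u' v'" for r
    using that sym[OF assms] by (auto simp: doubleton_eq_iff)
qed

end

lemma walk_edges_simps [simp]:
  "walk_edges [] = []" "walk_edges [x] = []"
  "walk_edges (x # y # zs) = {x, y} # walk_edges (y # zs)"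
  by (simp_all add: walk_edges_def)

context semimetric
begin

lemma sum_walk_edges:
  "set p \<subseteq> U \<Longrightarrow> sum_list (map (edge_weight w) (walk_edges p)) = walk_weight w p"
  by (induction p rule: induct_list012) (auto simp: edge_weight_pair)

lemma euler_tour_shortcut_le:
  assumes "finite T" "finite M" "euler_tour U (mset_set T + mset_set M) p"
    and "hd p = r" "r \<in> U" "subseq (r # us) p"
  shows "walk_weight w (r # us @ [r]) \<le> edges_weight w T + edges_weight w M"
proof -
  have p: "p \<noteq> []" "hd p = last p" "set p \<subseteq> U" "mset (walk_edges p) = mset_set T + mset_set M"
    using assms(3) by (auto simp: euler_tour_def)
  \<comment> \<open>A second copy of \<open>r\<close>, at cost \<open>w r r = 0\<close>, makes the
    subsequence \<open>r # us\<close> of \<open>p\<close> the inner part of a walk with fixed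
    ends.\<close>
  have "walk_weight w (r # us @ [r]) = walk_weight w (r # (r # us) @ [r])"
    using refl0 assms by simp
  also have "\<dots> \<le> walk_weight w (r # p @ [r])"
    using assms p by (intro walk_weight_shortcut) auto
  also have "\<dots> = walk_weight w p"
    using p assms refl0[of r] by (simp add: walk_weight_Cons walk_weight_append)
  also have "\<dots> = sum_list (map (edge_weight w) (walk_edges p))"
    using p by (simp add: sum_walk_edges)
  also have "\<dots> = sum_mset (image_mset (edge_weight w) (mset (walk_edges p)))"
    by (metis mset_map sum_mset_sum_list)
  also have "\<dots> = edges_weight w T + edges_weight w M"
    unfolding p(4) by (simp add: edges_weight_def sum_unfold_sum_mset)
  finally show ?thesis .
qed

end

section \<open>Matchings\<close>

text \<open>Every second edge of the walk, starting with the first. The list and its tail thus give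
  the two alternating classes of edges.\<close>

fun alternate_weight :: "('a \<Rightarrow> 'a \<Rightarrow> real) \<Rightarrow> 'a list \<Rightarrow> real" where
  "alternate_weight w (x # y # zs) = w x y + alternate_weight w zs"
| "alternate_weight w zs = 0"

lemma alternate_weight_tl:
  "alternate_weight w xs + alternate_weight w (tl xs) = walk_weight w xs"
  by (induction xs rule: induct_list012) auto

lemma alternate_weight_snoc:
  "even (length xs) \<Longrightarrow> alternate_weight w (xs @ [x]) = alternate_weight w xs"
  by (induction w xs rule: alternate_weight.induct) auto

lemma perfect_matching_insert:
  assumes "perfect_matching W M" "x \<noteq> y" "x \<notin> W" "y \<notin> W"
  shows "perfect_matching (insert x (insert y W)) (insert {x, y} M)" "{x, y} \<notin> M"
proof -
  have M: "M \<subseteq> complete_edges W" "\<forall>v\<in>W. \<exists>!e. e \<in> M \<and> v \<in> e"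
    using assms by (auto simp: perfect_matching_def)
  have sub: "\<forall>e\<in>M. e \<subseteq> W" using M(1) by (auto simp: complete_edges_def)
  show "{x, y} \<notin> M" using sub assms by auto
  have "insert {x, y} M \<subseteq> complete_edges (insert x (insert y W))"
    using M(1) assms(2) unfolding complete_edges_def by blast
  moreover have "\<exists>!e. e \<in> insert {x, y} M \<and> v \<in> e" if "v \<in> insert x (insert y W)" for v
  proof (cases "v \<in> W")
    case True
    then have "v \<noteq> x" "v \<noteq> y" using assms by auto
    then have "(\<lambda>e. e \<in> insert {x, y} M \<and> v \<in> e) = (\<lambda>e. e \<in> M \<and> v \<in> e)" by auto
    then show ?thesis using M(2) True by simp
  next
    case False
    then have "v \<in> {x, y}" "\<forall>e\<in>M. v \<notin> e" using that sub by auto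
    then show ?thesis by blast
  qed
  ultimately show "perfect_matching (insert x (insert y W)) (insert {x, y} M)"
    by (simp add: perfect_matching_def)
qed

lemma (in semimetric) alternate_matching:
  assumes "even (length zs)" "distinct zs" "set zs \<subseteq> U"
  shows "\<exists>M. perfect_matching (set zs) M \<and> finite M \<and> edges_weight w M = alternate_weight w zs"
  using assms
proof (induction zs rule: induct_list012)
  case 1
  have "perfect_matching {} {}" by (simp add: perfect_matching_def)
  then show ?case by (force simp: edges_weight_def)
next
  case (3 x y zs)
  then obtain M where M: "perfect_matching (set zs) M" "finite M"
    "edges_weight w M = alternate_weight w zs" by auto
  note M' = perfect_matching_insert[OF M(1), of x y]
  have "edges_weight w (insert {x, y} M) = w x y + alternate_weight w zs"
    using M M'(2) 3 by (simp add: edges_weight_def edge_weight_pair)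
  then show ?case using M M'(1) 3 by (intro exI[of _ "insert {x, y} M"]) auto
qed auto

text \<open>The edges of the matching partition \<open>W\<close> into pairs. This yields the parity
  of the set of odd vertices without counting degrees in the tree.\<close>

lemma perfect_matching_even_card:
  assumes "perfect_matching W M" "finite W"
  shows "even (card W)"
proof -
  have M: "M \<subseteq> complete_edges W" "\<forall>v\<in>W. \<exists>!e. e \<in> M \<and> v \<in> e"
    using assms by (auto simp: perfect_matching_def)
  have 2: "card e = 2" "e \<subseteq> W" if "e \<in> M" for e
    using M(1) that by (auto simp: complete_edges_def)
  have un: "\<Union>M = W" using M(2) 2 by blast
  have "pairwise disjnt M"
    using M(2) 2(2) unfolding pairwise_def disjnt_def by blast
  then have "card (\<Union>M) = sum card M"
    using 2 assms by (intro card_Union_disjoint) (auto intro: finite_subset)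
  also have "\<dots> = 2 * card M" using 2 by simp
  finally show ?thesis using un by simp
qed

context semimetric
begin

text \<open>List the vertices of \<open>W\<close> in the order of the tours. The cycle through them
  has even length and splits into two perfect matchings, neither lighter than
  \<open>M\<close>.\<close>

lemma minimum_perfect_matching_le:
  assumes "minimum_perfect_matching W w M" "finite U" "W \<subseteq> U" "r \<in> U"
    and "\<And>X. X \<in> set Xs \<Longrightarrow> set X \<subseteq> U" "distinct (r # concat Xs)" "set (r # concat Xs) = U"
  shows "2 * edges_weight w M \<le> (\<Sum>X\<leftarrow>Xs. walk_weight w (r # X @ [r]))"
proof -
  define Z where "Z = filter (\<lambda>x. x \<in> W) (r # concat Xs)"
  have Z: "distinct Z" "set Z = W"
    unfolding Z_def using assms by (auto intro: distinct_filter)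
  have le: "walk_weight w (r # Z @ [r]) \<le> (\<Sum>X\<leftarrow>Xs. walk_weight w (r # X @ [r]))"
  proof -
    have "walk_weight w (r # Z @ [r]) \<le> walk_weight w (r # (r # concat Xs) @ [r])"
      using assms unfolding Z_def by (intro walk_weight_shortcut) auto
    also have "\<dots> = walk_weight w (r # concat Xs @ [r])"
      using assms refl0 by simp
    also have "\<dots> \<le> (\<Sum>X\<leftarrow>Xs. walk_weight w (r # X @ [r]))"
      using assms by (intro walk_weight_concat_le) auto
    finally show ?thesis .
  qed
  have min: "edges_weight w M \<le> edges_weight w M'" if "perfect_matching W M'" for M'
    using assms(1) that by (auto simp: minimum_perfect_matching_def)
  have "perfect_matching W M" using assms by (auto simp: minimum_perfect_matching_def)
  then have "even (card W)"
    using assms by (auto intro: perfect_matching_even_card finite_subset)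
  then have even: "even (length Z)" using Z distinct_card by metis
  have bound: "edges_weight w M \<le> alternate_weight w Z'"
    if "distinct Z'" "set Z' = W" "even (length Z')" for Z'
    using alternate_matching[of Z'] that assms min by force
  show ?thesis
  proof (cases "Z = []")
    case True
    then have "edges_weight w M \<le> 0" using bound[of Z] Z by simp
    moreover have "0 \<le> walk_weight w (r # Z @ [r])"
      using assms Z by (intro walk_weight_nonneg) auto
    ultimately show ?thesis using le by simp
  next
    case False
    then obtain z zs where z: "Z = z # zs" by (cases Z) auto
    \<comment> \<open>One class of edges of the closed cycle matches up \<open>Z\<close>, the other
      matches up \<open>zs @ [z]\<close>, which is \<open>Z\<close> rotated by one.\<close>
    have "alternate_weight w (Z @ [hd Z]) + alternate_weight w (tl (Z @ [hd Z])) =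
       walk_weight w (Z @ [hd Z])"
      by (rule alternate_weight_tl)
    then have "alternate_weight w Z + alternate_weight w (zs @ [z]) = walk_weight w (Z @ [hd Z])"
      unfolding alternate_weight_snoc[OF even] by (simp add: z)
    moreover have "edges_weight w M \<le> alternate_weight w (zs @ [z])"
      using Z z even by (intro bound) auto
    moreover have "walk_weight w (Z @ [hd Z]) \<le> walk_weight w (r # Z @ [r])"
      using assms Z False by (intro closed_walk_le) auto
    ultimately show ?thesis using bound[OF Z even] le by linarith
  qed
qed

end

section \<open>Spanning trees\<close>

lemma walk_edges_append:
  assumes "xs \<noteq> []" "ys \<noteq> []"
  shows "walk_edges (xs @ ys) = walk_edges xs @ {last xs, hd ys} # walk_edges ys"
  using assms
proof (induction xs rule: induct_list012)
  case (2 x)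
  then show ?case by (cases ys) auto
qed auto

lemma connected_on_insert:
  assumes "connected_on U T" "u \<in> U"
  shows "connected_on (insert v U) (insert {u, v} T)"
  unfolding connected_on_def
proof (intro ballI)
  let ?walk = "\<lambda>a b p. p \<noteq> [] \<and> hd p = a \<and> last p = b \<and> set p \<subseteq> insert v U \<and>
     set (walk_edges p) \<subseteq> insert {u, v} T"
  fix x y assume xy: "x \<in> insert v U" "y \<in> insert v U"
  have old: "\<exists>p. ?walk a b p" if "a \<in> U" "b \<in> U" for a b
  proof -
    obtain p where "p \<noteq> []" "hd p = a" "last p = b" "set p \<subseteq> U" "set (walk_edges p) \<subseteq> T"
      using assms(1) \<open>a \<in> U\<close> \<open>b \<in> U\<close> unfolding connected_on_def by metis
    then show ?thesis by (intro exI[of _ p]) auto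
  qed
  have vx: "\<exists>p. ?walk v b p" if b: "b \<in> U" for b
  proof -
    obtain p where "?walk u b p" using old[OF assms(2) b] by blast
    then show ?thesis by (intro exI[of _ "v # p"]) (cases p; auto)
  qed
  have xv: "\<exists>p. ?walk a v p" if a: "a \<in> U" for a
  proof -
    obtain p where "?walk a u p" using old[OF a assms(2)] by blast
    then show ?thesis by (intro exI[of _ "p @ [v]"]) (auto simp: walk_edges_append)
  qed
  have vv: "\<exists>p. ?walk v v p" by (intro exI[of _ "[v]"]) auto
  show "\<exists>p. ?walk x y p"
  proof (cases "x = v"; cases "y = v")
    assume "x = v" "y = v"
    then show ?thesis using vv by simp
  next
    assume "x = v" "y \<noteq> v"
    then show ?thesis using vx[of y] xy by simp
  next
    assume "x \<noteq> v" "y = v"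
    then show ?thesis using xv[of x] xy by simp
  next
    assume "x \<noteq> v" "y \<noteq> v"
    then show ?thesis using old[of x y] xy by simp
  qed
qed

lemma walk_edges_nth: "Suc i < length p \<Longrightarrow> {p ! i, p ! Suc i} \<in> set (walk_edges p)"
proof (induction p arbitrary: i rule: induct_list012)
  case (3 x y zs)
  show ?case using "3.IH"(2)[of "i - 1"] "3.prems" by (cases i) auto
qed auto

lemma mem_walk_edgesD: "e \<in> set (walk_edges p) \<Longrightarrow> e \<subseteq> set p"
  by (induction p rule: induct_list012) auto

text \<open>Since \<open>{u, v}\<close> is the only edge at \<open>v\<close>, both neighbours of
  \<open>v\<close> on a cycle would be \<open>u\<close>, but on a cycle of at least three vertices
  they differ.\<close>

lemma has_cycle_insertD:
  assumes cyc: "has_cycle (insert {u, v} T)" and "v \<notin> \<Union>T" "u \<noteq> v"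
  shows "has_cycle T"
proof -
  obtain c where c: "3 \<le> length c" "distinct c" "set (walk_edges (c @ [hd c])) \<subseteq> insert {u, v} T"
    using cyc unfolding has_cycle_def by blast
  have "v \<notin> set c"
  proof
    assume "v \<in> set c"
    then obtain i where i: "i < length c" "c ! i = v" by (auto simp: in_set_conv_nth)
    let ?n = "length c"
    \<comment> \<open>Cyclic predecessor and successor of position \<open>i\<close>.\<close>
    let ?p = "if i = 0 then ?n - 1 else i - 1" and ?q = "if Suc i = ?n then 0 else Suc i"
    have edge: "{(c @ [hd c]) ! j, (c @ [hd c]) ! Suc j} \<in> insert {u, v} T" if "j < ?n" for j
      using c(3) walk_edges_nth[of j "c @ [hd c]"] that by auto
    have hd: "hd c = c ! 0" using c(1) by (intro hd_conv_nth) auto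
    have "{c ! i, c ! ?q} \<in> insert {u, v} T"
      using edge[of i] i c(1) hd by (auto simp: nth_append split: if_splits)
    moreover have "{c ! ?p, c ! i} \<in> insert {u, v} T"
    proof (cases i)
      case 0
      obtain m where "?n = Suc m" using c(1) by (cases ?n) auto
      with 0 edge[of m] hd show ?thesis by (simp add: nth_append)
    next
      case (Suc j)
      with edge[of j] i(1) show ?thesis by (simp add: nth_append)
    qed
    moreover have "e = {u, v}" if "e \<in> insert {u, v} T" "v \<in> e" for e
      using assms(2) that by auto
    ultimately have "{c ! i, c ! ?q} = {u, v}" "{c ! ?p, c ! i} = {u, v}"
      unfolding i(2) by blast+
    then have "{v, c ! ?q} = {u, v}" "{c ! ?p, v} = {u, v}"
      unfolding i(2) .
    then have "c ! ?q = u" "c ! ?p = u" using assms(3) by (auto simp: doubleton_eq_iff)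
    then have eq: "c ! ?q = c ! ?p" by (rule trans[OF _ sym])
    have neq: "?q \<noteq> ?p" and "?q < ?n" "?p < ?n" using c(1) i by auto
    then have "?q = ?p" by (intro iffD1[OF nth_eq_iff_index_eq[OF c(2)] eq])
    with neq show False by (rule notE)
  qed
  then have "v \<notin> set (c @ [hd c])" using c(1) by (cases c) auto
  then have "{u, v} \<notin> set (walk_edges (c @ [hd c]))" using mem_walk_edgesD by fastforce
  then show ?thesis using c unfolding has_cycle_def by blast
qed

lemma spanning_tree_insert_leaf:
  assumes "spanning_tree U T" "u \<in> U" "v \<notin> U"
  shows "spanning_tree (insert v U) (insert {u, v} T)" "{u, v} \<notin> T"
proof -
  have T: "T \<subseteq> complete_edges U" "connected_on U T" "\<not> has_cycle T"
    using assms by (auto simp: spanning_tree_def)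
  have v: "v \<notin> \<Union>T" using T(1) assms by (auto simp: complete_edges_def)
  then show "{u, v} \<notin> T" by auto
  have "insert {u, v} T \<subseteq> complete_edges (insert v U)"
    using T(1) assms unfolding complete_edges_def by blast
  moreover have "\<not> has_cycle (insert {u, v} T)"
    using has_cycle_insertD[OF _ v] T(3) assms by auto
  ultimately show "spanning_tree (insert v U) (insert {u, v} T)"
    using connected_on_insert[OF T(2) assms(2)] by (simp add: spanning_tree_def)
qed

lemma finite_complete_edges: "finite U \<Longrightarrow> finite (complete_edges U)"
  by (rule finite_subset[of _ "Pow U"]) (auto simp: complete_edges_def)

context semimetric
begin

text \<open>The path grows leaf by leaf, and each new vertex is the next point of attachment; so
  \<open>r\<close> is generalised along with \<open>A\<close> and \<open>T\<close>.\<close>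

lemma spanning_tree_add_path:
  assumes "spanning_tree A T" "finite T" "r \<in> A" "A \<subseteq> U" "set Y \<subseteq> U" "distinct Y" "set Y \<inter> A = {}"
  shows "\<exists>T'. spanning_tree (A \<union> set Y) T' \<and> finite T' \<and>
    edges_weight w T' = edges_weight w T + walk_weight w (r # Y)"
  using assms
proof (induction Y arbitrary: A T r)
  case (Cons y Y)
  note ext = spanning_tree_insert_leaf[OF Cons.prems(1,3), of y]
  have "edges_weight w (insert {r, y} T) = edges_weight w T + w r y"
    using ext Cons.prems by (auto simp: edges_weight_def edge_weight_pair subset_iff)
  moreover have "\<exists>T'. spanning_tree (insert y A \<union> set Y) T' \<and> finite T' \<and>
    edges_weight w T' = edges_weight w (insert {r, y} T) + walk_weight w (y # Y)"
    using ext Cons.prems by (intro Cons.IH) auto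
  ultimately show ?case by (auto simp: add_ac)
qed auto

lemma spanning_tree_of_paths:
  assumes "r \<in> U" "distinct (r # concat Ys)" "set (concat Ys) \<subseteq> U"
  shows "\<exists>T. spanning_tree (insert r (set (concat Ys))) T \<and> finite T \<and>
    edges_weight w T = (\<Sum>Y\<leftarrow>Ys. walk_weight w (r # Y))"
  using assms(2,3)
proof (induction Ys)
  case Nil
  have "\<not> has_cycle ({} :: 'a set set)"
  proof
    assume "has_cycle ({} :: 'a set set)"
    then obtain c :: "'a list" where c: "3 \<le> length c" "set (walk_edges (c @ [hd c])) \<subseteq> {}"
      unfolding has_cycle_def by blast
    then obtain x y zs where "c = x # y # zs"
      by (cases c rule: remdups_adj.cases) auto
    with c(2) show False by simp
  qed
  moreover have "connected_on {r} {}"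
    unfolding connected_on_def by (intro ballI exI[of _ "[r]"]) auto
  ultimately have "spanning_tree {r} {}" by (simp add: spanning_tree_def)
  then show ?case by (auto simp: edges_weight_def)
next
  case (Cons Y Ys)
  then obtain T where T: "spanning_tree (insert r (set (concat Ys))) T" "finite T"
    "edges_weight w T = (\<Sum>Y\<leftarrow>Ys. walk_weight w (r # Y))" by auto
  have "\<exists>T'. spanning_tree (insert r (set (concat Ys)) \<union> set Y) T' \<and> finite T' \<and>
    edges_weight w T' = edges_weight w T + walk_weight w (r # Y)"
    using T Cons.prems assms(1) by (intro spanning_tree_add_path) auto
  then show ?case using T(3) by (auto simp: Un_commute add_ac)
qed

end

section \<open>Averaging over the solutions of AG-ITP\<close>

text \<open>The later blocks stay the same. In the first tour, nonempty as \<open>i > 0\<close>, the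
  edge from \<open>r\<close> to \<open>hd us\<close> is replaced by the path over
  \<open>x\<close>.\<close>

lemma itp_cost_Cons_Suc:
  assumes "us \<noteq> []" "i > 0"
  shows "itp_cost r w k (x # us) (Suc i) = itp_cost r w k us i + w r x + w x (hd us) - w r (hd us)"
  using assms by (cases us; cases i) (auto simp: itp_cost_def)

text \<open>With \<open>x\<close> alone in its tour, \<open>us\<close> is cut into blocks of size
  \<open>k\<close> from its start, which is the solution for \<open>us\<close> with
  \<open>i = k\<close>.\<close>

lemma itp_cost_Cons_1:
  assumes "us \<noteq> []" "k > 0"
  shows "itp_cost r w k (x # us) 1 = itp_cost r w k us k + w r x + w x r"
  using assms by (subst (1 2) itp_cost_def) (simp add: blocks.simps[of k us])

lemma sum_itp_cost:
  assumes "k > 0" "w r r = 0" "\<And>u. u \<in> set us \<Longrightarrow> w u r = w r u"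
  shows "(\<Sum>i=1..k. itp_cost r w k us i) =
    (real k - 1) * walk_weight w (r # us @ [r]) + 2 * (\<Sum>u\<leftarrow>us. w r u)"
  using assms(3)
proof (induction us)
  case Nil
  then show ?case using assms by (simp add: itp_cost_def blocks.simps[of k "[]"])
next
  case (Cons x us)
  show ?case
  proof (cases "us = []")
    case True
    have "itp_cost r w k (x # us) i = 2 * w r x" if "i \<in> {1..k}" for i
      using that True Cons.prems by (cases i) (auto simp: itp_cost_def blocks.simps[of k "[]"])
    then show ?thesis using True Cons.prems by (simp add: algebra_simps)
  next
    case False
    let ?y = "hd us"
    obtain m where m: "k = Suc m" using assms(1) by (cases k) auto
    \<comment> \<open>Prepending \<open>x\<close> shifts the \<open>k\<close> solutions cyclically:
      \<open>i < k\<close> becomes \<open>i + 1\<close>, and \<open>k\<close> becomes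
      \<open>1\<close>.\<close>
    have "(\<Sum>i=1..k. itp_cost r w k (x # us) i) =
        itp_cost r w k (x # us) 1 + (\<Sum>i=1..m. itp_cost r w k (x # us) (Suc i))"
      unfolding m by (simp add: sum.atLeast_Suc_atMost sum.atLeast_Suc_atMost_Suc_shift del: sum.cl_ivl_Suc)
    also have "\<dots> = (\<Sum>i=1..k. itp_cost r w k us i) + 2 * w r x
        + real m * (w r x + w x ?y - w r ?y)"
      using False assms(1) Cons.prems
      by (simp add: itp_cost_Cons_1[simplified] itp_cost_Cons_Suc sum.distrib sum_subtractf m algebra_simps)
    also have "\<dots> = (real k - 1) * walk_weight w (r # us @ [r]) + 2 * (\<Sum>u\<leftarrow>us. w r u)
        + 2 * w r x + real m * (w r x + w x ?y - w r ?y)"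
      using Cons by simp
    finally show ?thesis using False by (simp add: m walk_weight_Cons algebra_simps)
  qed
qed

lemma agitp_cost_le_average:
  assumes "k > 0" "w r r = 0" "\<And>u. u \<in> set us \<Longrightarrow> w u r = w r u"
  shows "real k * agitp_cost r w k us \<le>
    (real k - 1) * walk_weight w (r # us @ [r]) + 2 * (\<Sum>u\<leftarrow>us. w r u)"
proof -
  have "(\<Sum>i=1..k. agitp_cost r w k us) \<le> (\<Sum>i=1..k. itp_cost r w k us i)"
    unfolding agitp_cost_def by (intro sum_mono Min_le) auto
  then show ?thesis using sum_itp_cost[of k w r us] assms by simp
qed

section \<open>A single tour\<close>

context semimetric
begin

text \<open>Indices start at \<open>0\<close>, so \<open>X ! i\<close> is reached from the depot
  over \<open>i + 1\<close> edges.\<close>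

lemma dist_depot_le_take:
  assumes "r \<in> U" "set X \<subseteq> U" "i < length X" "m \<ge> 0"
    and edge: "\<And>i. i < length X \<Longrightarrow> w ((r # X) ! i) (X ! i) \<le> m"
  shows "w r (X ! i) \<le> (real i + 1) * m"
  using assms(3)
proof (induction i)
  case 0
  then show ?case using edge[of 0] by simp
next
  case (Suc i)
  have "X ! i \<in> U" "X ! Suc i \<in> U" using assms(2) Suc.prems by (auto simp: subset_iff)
  then have "w r (X ! Suc i) \<le> w r (X ! i) + w (X ! i) (X ! Suc i)"
    using tri assms(1) by blast
  also have "\<dots> \<le> (real i + 1) * m + m"
    using Suc edge[of "Suc i"] by (intro add_mono) auto
  finally show ?case by (simp add: algebra_simps)
qed

text \<open>The first and last \<open>j\<close> customers are charged by their distance along the tour, the others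
  by half the tour length.\<close>

lemma sum_dist_depot_le:
  assumes "r \<in> U" "set X \<subseteq> U" "m \<ge> 0" "length X \<le> k" "2 * j \<le> k"
    and edge: "\<And>i. i \<le> length X \<Longrightarrow> w ((r # X @ [r]) ! i) ((X @ [r]) ! i) \<le> m"
  shows "(\<Sum>x\<leftarrow>X. w r x) \<le>
    real j * (real j + 1) * m + (real k - 2 * real j) * (walk_weight w (r # X @ [r]) / 2)"
proof -
  let ?n = "length X" and ?c = "walk_weight w (r # X @ [r])"
  \<comment> \<open>\<open>?F\<close> charges the first \<open>j\<close> positions and, read from
    the rear, the last \<open>j\<close>; \<open>?M\<close> charges the others. On a short tour both
    ends overlap, which is harmless as all charges are nonnegative.\<close>
  let ?F = "\<lambda>i. if i < j then (real i + 1) * m else 0"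
  let ?M = "\<lambda>i. if i < j \<or> ?n - 1 - i < j then 0 else ?c / 2"
  have c0: "?c \<ge> 0" using assms by (intro walk_weight_nonneg) auto
  have U: "X ! i \<in> U" if "i < ?n" for i using assms(2) that by (auto simp: subset_iff)
  have front: "w r (X ! i) \<le> (real i + 1) * m" if "i < ?n" for i
  proof (rule dist_depot_le_take[OF assms(1,2) that assms(3)])
    show "w ((r # X) ! i) (X ! i) \<le> m" if "i < ?n" for i
      using edge[of i] that by (auto simp: nth_append nth_Cons' split: if_splits)
  qed
  \<comment> \<open>The same bound for the reversed tour, whose edges have the same weights by
    symmetry.\<close>
  have rear: "w r (X ! i) \<le> (real (?n - 1 - i) + 1) * m" if "i < ?n" for i
  proof -
    have "w r (rev X ! (?n - 1 - i)) \<le> (real (?n - 1 - i) + 1) * m"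
    proof (rule dist_depot_le_take)
      show "w ((r # rev X) ! i) (rev X ! i) \<le> m" if i: "i < length (rev X)" for i
      proof -
        have "w ((X @ [r]) ! (?n - Suc i)) ((X @ [r]) ! (?n - i)) \<le> m"
        proof -
          have "?n - i = Suc (?n - Suc i)" using i by simp
          with edge[of "?n - i"] show ?thesis by simp
        qed
        moreover have "(X @ [r]) ! (?n - Suc i) = rev X ! i"
          using i diff_Suc_less[of ?n i] by (cases "?n = 0") (auto simp: nth_append rev_nth)
        moreover have "(X @ [r]) ! (?n - i) = (r # rev X) ! i"
          using i by (cases i) (auto simp: nth_append rev_nth)
        moreover have "rev X ! i \<in> U" "(r # rev X) ! i \<in> U"
          using i assms(1) U by (auto simp: rev_nth nth_Cons')
        ultimately show ?thesis using sym by metis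
      qed
    qed (use assms that in auto)
    then show ?thesis using that by (simp add: rev_nth)
  qed
  have half: "w r (X ! i) \<le> ?c / 2" if "i < ?n" for i
  proof -
    \<comment> \<open>The tour is shortcut to a round trip to one customer.\<close>
    have "walk_weight w (r # [X ! i] @ [r]) \<le> ?c"
      using that assms by (intro walk_weight_shortcut) (auto simp: subseq_singleton_left)
    then show ?thesis using sym[OF assms(1) U[OF that]] by simp
  qed
  have F: "(\<Sum>i<?n. ?F i) \<le> real j * (real j + 1) / 2 * m"
  proof -
    have "(\<Sum>i<?n. ?F i) = (\<Sum>i\<in>{..<?n} \<inter> {..<j}. (real i + 1) * m)"
      by (simp add: sum.If_cases lessThan_def Int_def)
    also have "\<dots> \<le> (\<Sum>i<j. (real i + 1) * m)"
      using assms(3) by (intro sum_mono2) auto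
    also have "\<dots> = real j * (real j + 1) / 2 * m"
      by (induction j) (auto simp: field_simps)
    finally show ?thesis .
  qed
  have B: "(\<Sum>i<?n. ?F (?n - 1 - i)) = (\<Sum>i<?n. ?F i)"
    using sum.nat_diff_reindex[of ?F ?n] by (simp only: diff_diff_left plus_1_eq_Suc)
  have M: "(\<Sum>i<?n. ?M i) \<le> (real k - 2 * real j) * (?c / 2)"
  proof -
    have "(\<Sum>i<?n. ?M i) \<le> (\<Sum>i\<in>{j..<?n - j}. ?c / 2)"
    proof -
      have "(\<Sum>i<?n. ?M i) = (\<Sum>i\<in>{..<?n} \<inter> {i. \<not> (i < j \<or> ?n - 1 - i < j)}. ?c / 2)"
        by (auto simp: sum.If_cases intro!: arg_cong[where f = card])
      also have "\<dots> \<le> (\<Sum>i\<in>{j..<?n - j}. ?c / 2)"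
        using c0 by (intro sum_mono2) auto
      finally show ?thesis .
    qed
    also have "\<dots> = real (?n - j - j) * (?c / 2)" by simp
    \<comment> \<open>For fewer than \<open>2 * j\<close> customers the truncated difference is
      \<open>0\<close>, and the right side is nonnegative by \<open>2 * j \<le> k\<close>.\<close>
    also have "\<dots> \<le> (real k - 2 * real j) * (?c / 2)"
      using c0 assms(4,5) by (intro mult_right_mono) auto
    finally show ?thesis .
  qed
  have "(\<Sum>x\<leftarrow>X. w r x) = (\<Sum>i<?n. w r (X ! i))"
    by (simp add: sum_list_sum_nth atLeast0LessThan)
  also have "\<dots> \<le> (\<Sum>i<?n. ?F i + ?F (?n - 1 - i) + ?M i)"
  proof (rule sum_mono)
    fix i assume "i \<in> {..<?n}"
    then have i: "i < ?n" by simp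
    have "0 \<le> ?F i" "0 \<le> ?F (?n - 1 - i)" "0 \<le> ?M i" using assms(3) c0 by auto
    then show "w r (X ! i) \<le> ?F i + ?F (?n - 1 - i) + ?M i"
      using front[OF i] rear[OF i] half[OF i] by (smt (verit))
  qed
  also have "\<dots> = (\<Sum>i<?n. ?F i) + (\<Sum>i<?n. ?F (?n - 1 - i)) + (\<Sum>i<?n. ?M i)"
    by (simp add: sum.distrib)
  also have "\<dots> \<le> 2 * (real j * (real j + 1) / 2 * m) + (real k - 2 * real j) * (?c / 2)"
    using F M unfolding B by linarith
  finally show ?thesis by simp
qed

text \<open>Removing a longest edge leaves two paths that start at the depot, \<open>B\<close> being
  walked backwards. Either may consist of the depot alone.\<close>

lemma cut_longest_edge:
  assumes "r \<in> U" "set X \<subseteq> U"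
  obtains A B m where "X = A @ B"
    "walk_weight w (r # X @ [r]) = walk_weight w (r # A) + m + walk_weight w (r # rev B)"
    "m \<ge> 0" "\<And>i. i \<le> length X \<Longrightarrow> w ((r # X @ [r]) ! i) ((X @ [r]) ! i) \<le> m"
proof -
  let ?e = "\<lambda>i. w ((r # X @ [r]) ! i) ((X @ [r]) ! i)"
  define m where "m = Max (?e ` {..length X})"
  have "m \<in> ?e ` {..length X}" unfolding m_def by (intro Max_in) auto
  then obtain i where i: "i \<le> length X" "?e i = m" by auto
  let ?A = "take i X" and ?B = "drop i X"
  have split: "r # X @ [r] = (r # ?A) @ (?B @ [r])" by simp
  have last: "last (r # ?A) = (r # X @ [r]) ! i"
    using i by (cases i) (auto simp: last_conv_nth nth_append)
  have hd: "hd (?B @ [r]) = (X @ [r]) ! i"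
    using i by (cases "i = length X") (auto simp: hd_drop_conv_nth nth_append)
  have "set (?B @ [r]) \<subseteq> U" using assms set_drop_subset[of i X] by auto
  then have "walk_weight w (?B @ [r]) = walk_weight w (r # rev ?B)"
    using walk_weight_rev[of "?B @ [r]"] by simp
  then have w: "walk_weight w (r # X @ [r]) = walk_weight w (r # ?A) + m + walk_weight w (r # rev ?B)"
    unfolding split by (subst walk_weight_append) (use i hd last in auto)
  have "set (r # X @ [r]) \<subseteq> U" using assms by auto
  then have "(r # X @ [r]) ! i \<in> U" "(X @ [r]) ! i \<in> U"
    using i by (auto simp: nth_append nth_Cons' subset_iff)
  then have "m \<ge> 0" using i nonneg by metis
  moreover have "?e i \<le> m" if "i \<le> length X" for i
    unfolding m_def using that by (intro Max_ge) auto
  ultimately show thesis using that[of ?A ?B m] w by simp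
qed

end

section \<open>The parameter \<open>l\<close> and the ratio\<close>

text \<open>The number \<open>x\<close> under the ceiling solves
  \<open>2 * x * (x + 1) = k - 1\<close>. The last two bounds make the weights in
  \<open>ratio_combination\<close> nonnegative; \<open>2 * l \<le> k\<close> admits
  \<open>j = l\<close> in \<open>sum_dist_depot_le\<close>.\<close>

lemma ratio_parameter:
  assumes "k \<ge> 3" "l = nat \<lceil>(sqrt (2 * real k - 1) - 1) / 2\<rceil>"
  shows "l \<ge> 1" "2 * l \<le> k" "2 * real l * (real l - 1) \<le> real k - 1"
    "real k - 1 \<le> 2 * real l * (real l + 1)"
proof -
  define x where "x = (sqrt (2 * real k - 1) - 1) / 2"
  have "1 < sqrt (2 * real k - 1)" using assms(1) by (simp add: real_less_rsqrt)
  then have x: "x > 0" by (simp add: x_def)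
  then have l: "real l = of_int \<lceil>x\<rceil>" using assms(2) by (simp add: x_def)
  then have lx: "x \<le> real l" "real l < x + 1" by linarith+
  have "2 * x + 1 = sqrt (2 * real k - 1)" by (simp add: x_def field_simps)
  then have sq: "(2 * x + 1)\<^sup>2 = 2 * real k - 1" using assms(1) by simp
  show l1: "l \<ge> 1" using lx x by linarith
  have "(2 * x + 1)\<^sup>2 \<le> (2 * real l + 1)\<^sup>2" using lx x by (intro power_mono) auto
  then show "real k - 1 \<le> 2 * real l * (real l + 1)"
    unfolding sq by (simp add: power2_eq_square algebra_simps)
  have "(2 * real l - 1)\<^sup>2 < (2 * x + 1)\<^sup>2"
    using lx l1 by (intro power_strict_mono) auto
  then have low: "2 * real l * (real l - 1) < real k - 1"
    unfolding sq by (simp add: power2_eq_square algebra_simps)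
  then show "2 * real l * (real l - 1) \<le> real k - 1" by simp
  \<comment> \<open>Both sides of \<open>low\<close> are integers, so the strict inequality gains
    one. This gain completes the square \<open>(l - 1)\<^sup>2\<close> below.\<close>
  have "real (2 * l * l + 1) < real (k + 2 * l)"
    using low by (simp add: algebra_simps)
  then have "2 * l * l + 1 < k + 2 * l" unfolding of_nat_less_iff .
  then have "2 * (real l * real l) + 2 \<le> real k + 2 * real l"
    using of_nat_mono[of "2 * l * l + 2" "k + 2 * l", where 'a = real] by simp
  moreover have "0 \<le> (real l - 1)\<^sup>2" by simp
  ultimately have "2 * real l \<le> real k" by (simp add: power2_eq_square algebra_simps)
  then show "2 * l \<le> k" by linarith
qed

text \<open>Positivity of \<open>\<rho>\<close> later permits the division by \<open>\<rho>\<close>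
  in \<open>le_opt_cost\<close>.\<close>

lemma ratio_bounds:
  fixes k l :: nat
  assumes "k \<ge> 3" "l \<ge> 1" "2 * l \<le> k"
    and \<rho>: "\<rho> = 5 / 2 - (2 * (real l)\<^sup>2 + real k + real l - 1) / (2 * real k * real l)"
  shows "\<rho> > 0" "\<rho> < 5 / 2 - sqrt (2 / real k)"
proof -
  have kl: "real k > 0" "real l > 0" using assms by auto
  have "2 * real l * real l \<le> real k * real l" using assms by (intro mult_right_mono) auto
  moreover have "real k * 1 \<le> real k * real l" "1 * real l \<le> real k * real l"
    using assms by (intro mult_left_mono mult_right_mono; simp)+
  ultimately have "2 * (real l)\<^sup>2 + real k + real l - 1 < 5 / 2 * (2 * real k * real l)"
    using mult_pos_pos[OF kl] by (simp add: power2_eq_square)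
  then show "\<rho> > 0" using kl by (simp add: \<rho> divide_less_eq)
  define s where "s = sqrt (2 * real k)"
  \<comment> \<open>By \<open>k \<ge> 3\<close>, \<open>2 * k \<ge> 6 > 81 / 16\<close>. For
    \<open>k = 2\<close> and \<open>l = 1\<close> the strict bound would be an equality.\<close>
  have s: "s > 9 / 4" unfolding s_def using assms(1) by (intro real_less_rsqrt) (simp add: power2_eq_square)
  have s2: "s\<^sup>2 = 2 * real k" by (simp add: s_def)
  \<comment> \<open>Completing the square in \<open>l\<close>; the remainder is positive by the
    bound on \<open>s\<close>.\<close>
  have "0 < 2 * (real l + (1 - 2 * s) / 4)\<^sup>2 + (4 * s - 9) / 8"
    using s by (intro add_nonneg_pos) auto
  also have "\<dots> = 2 * (real l)\<^sup>2 + real k + real l - 1 - 2 * real l * s"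
    using s2 by (simp add: power2_eq_square field_simps)
  finally have "2 * real l * s < 2 * (real l)\<^sup>2 + real k + real l - 1" by simp
  then have "2 * real l * s / (2 * real k * real l) <
      (2 * (real l)\<^sup>2 + real k + real l - 1) / (2 * real k * real l)"
    using kl by (intro divide_strict_right_mono) auto
  moreover have "sqrt (2 / real k) = s / real k"
    using kl by (simp add: s_def real_sqrt_divide real_sqrt_mult field_simps)
  ultimately have "sqrt (2 / real k) < (2 * (real l)\<^sup>2 + real k + real l - 1) / (2 * real k * real l)"
    using kl by simp
  then show "\<rho> < 5 / 2 - sqrt (2 / real k)" by (simp add: \<rho>)
qed

text \<open>The cases \<open>j = l - 1\<close> and \<open>j = l\<close> of \<open>sum_dist_depot_le\<close> are combined with the weights
  that cancel the length \<open>m\<close> of the longest edge.\<close>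

lemma ratio_combination:
  fixes k l :: nat
  assumes "k > 0" "l \<ge> 1" "2 * real l * (real l - 1) \<le> real k - 1"
    "real k - 1 \<le> 2 * real l * (real l + 1)"
    and \<rho>: "\<rho> = 5 / 2 - (2 * (real l)\<^sup>2 + real k + real l - 1) / (2 * real k * real l)"
    and S0: "S \<le> (real l - 1) * real l * m + (real k - 2 * (real l - 1)) * (c / 2)"
    and S1: "S \<le> real l * (real l + 1) * m + (real k - 2 * real l) * (c / 2)"
  shows "(real k - 1) * (c - m + c / 2) + 2 * S \<le> \<rho> * real k * c"
proof -
  define h where "h = c / 2"
  have c: "c = 2 * h" by (simp add: h_def)
  \<comment> \<open>The weight \<open>?p\<close> goes with \<open>j = l\<close> and
    \<open>?q\<close> with \<open>j = l - 1\<close>. They add up to \<open>4 * l\<close>, and the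
    coefficients of \<open>m\<close> combine to \<open>2 * l * (k - 1)\<close>, which cancels the
    \<open>m\<close> from the tree.\<close>
  let ?p = "real k - 1 - 2 * real l * (real l - 1)" and ?q = "2 * real l * (real l + 1) - (real k - 1)"
  have "?p * S + ?q * S \<le> ?p * (real l * (real l + 1) * m + (real k - 2 * real l) * (c / 2))
      + ?q * ((real l - 1) * real l * m + (real k - 2 * (real l - 1)) * (c / 2))"
    using S0 S1 assms by (intro add_mono mult_left_mono) auto
  then have *: "4 * real l * ((real k - 1) * (c - m + c / 2) + 2 * S) \<le>
      (10 * real k * real l - 2 * (2 * (real l)\<^sup>2 + real k + real l - 1)) * c"
    unfolding c by (simp add: power2_eq_square algebra_simps)
  have "4 * real l * (\<rho> * real k * c) = (10 * real k * real l - 2 * (2 * (real l)\<^sup>2 + real k + real l - 1)) * c"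
    using assms(1,2) unfolding \<rho> by (simp add: field_simps)
  with * have "4 * real l * ((real k - 1) * (c - m + c / 2) + 2 * S) \<le> 4 * real l * (\<rho> * real k * c)"
    by (simp only:)
  moreover have "4 * real l > 0" using assms(2) by simp
  ultimately show ?thesis by (simp only: mult_le_cancel_left_pos)
qed

section \<open>The cost of AG-ITP against a partition into tours\<close>

text \<open>One tour's share of the final estimate: two paths for the tree, half its length for the
  matching, and its distances from the depot.\<close>

lemma (in semimetric) single_tour_bound:
  fixes k l :: nat
  assumes k: "k \<ge> 3" and l: "l = nat \<lceil>(sqrt (2 * real k - 1) - 1) / 2\<rceil>"
    and \<rho>: "\<rho> = 5 / 2 - (2 * (real l)\<^sup>2 + real k + real l - 1) / (2 * real k * real l)"
    and X: "r \<in> U" "set X \<subseteq> U" "length X \<le> k"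
  shows "\<exists>A B. X = A @ B \<and> (real k - 1) * (walk_weight w (r # A) + walk_weight w (r # rev B)
     + walk_weight w (r # X @ [r]) / 2) + 2 * (\<Sum>x\<leftarrow>X. w r x) \<le> \<rho> * real k * walk_weight w (r # X @ [r])"
proof -
  note p = ratio_parameter[OF k l]
  let ?c = "walk_weight w (r # X @ [r])" and ?S = "\<Sum>x\<leftarrow>X. w r x"
  obtain A B m where cut: "X = A @ B" "?c = walk_weight w (r # A) + m + walk_weight w (r # rev B)"
    "m \<ge> 0" "\<And>i. i \<le> length X \<Longrightarrow> w ((r # X @ [r]) ! i) ((X @ [r]) ! i) \<le> m"
    using cut_longest_edge[OF X(1,2)] by blast
  note S = sum_dist_depot_le[OF X(1,2) cut(3) X(3) _ cut(4)]
  have "?S \<le> (real l - 1) * real l * m + (real k - 2 * (real l - 1)) * (?c / 2)"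
    using S[of "l - 1"] p(1,2) by (simp add: of_nat_diff)
  then have "(real k - 1) * (?c - m + ?c / 2) + 2 * ?S \<le> \<rho> * real k * ?c"
    using S[of l] p k by (intro ratio_combination[OF _ p(1,3,4) \<rho>]) auto
  moreover have "?c - m = walk_weight w (r # A) + walk_weight w (r # rev B)"
    using cut(2) by simp
  ultimately show ?thesis using cut(1) by metis
qed

text \<open>Stated for lists of at most \<open>k\<close> customers, so that it covers unit-demand
  and expanded instances alike. Tree, matching and distance bounds are sums over the tours, so
  \<open>single_tour_bound\<close> applies termwise.\<close>

lemma agitp_cost_le_partition:
  fixes k l :: nat
  assumes k: "k \<ge> 3" and l: "l = nat \<lceil>(sqrt (2 * real k - 1) - 1) / 2\<rceil>"
    and \<rho>: "\<rho> = 5 / 2 - (2 * (real l)\<^sup>2 + real k + real l - 1) / (2 * real k * real l)"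
    and U: "semimetric (insert r V) w" "finite V" "r \<notin> V"
    and H: "christofides_cycle V r w us"
    and Xs: "distinct (concat Xs)" "set (concat Xs) = V" "\<And>X. X \<in> set Xs \<Longrightarrow> length X \<le> k"
  shows "agitp_cost r w k us \<le> \<rho> * (\<Sum>X\<leftarrow>Xs. walk_weight w (r # X @ [r]))"
proof -
  define U where "U = insert r V"
  interpret semimetric U w using U by (simp add: U_def)
  have rU: "r \<in> U" "finite U" using U by (auto simp: U_def)
  have XU: "set X \<subseteq> U" if "X \<in> set Xs" for X using that Xs(2) by (auto simp: U_def)
  obtain T M p where TM: "minimum_spanning_tree U w T"
    "minimum_perfect_matching (odd_vertices U T) w M"
    "euler_tour U (mset_set T + mset_set M) p" "hd p = r"
    and us: "distinct (r # us)" "set (r # us) = U" "subseq (r # us) p"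
    using H unfolding christofides_cycle_def Let_def U_def by blast
  have odd: "odd_vertices U T \<subseteq> U" by (auto simp: odd_vertices_def)
  have fin: "finite T" "finite M"
  proof -
    have "T \<subseteq> complete_edges U" "M \<subseteq> complete_edges (odd_vertices U T)"
      using TM(1,2) by (auto simp: minimum_spanning_tree_def spanning_tree_def
          minimum_perfect_matching_def perfect_matching_def)
    then show "finite T" "finite M"
      using rU(2) odd finite_subset finite_complete_edges by metis+
  qed
  let ?C = "\<Sum>X\<leftarrow>Xs. walk_weight w (r # X @ [r])"
  obtain f g where fg: "\<And>X. X \<in> set Xs \<Longrightarrow> X = f X @ g X \<and>
     (real k - 1) * (walk_weight w (r # f X) + walk_weight w (r # rev (g X))
       + walk_weight w (r # X @ [r]) / 2) + 2 * (\<Sum>x\<leftarrow>X. w r x)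
     \<le> \<rho> * real k * walk_weight w (r # X @ [r])"
    using single_tour_bound[OF k l \<rho> rU(1) XU Xs(3)] by metis
  let ?P = "\<Sum>X\<leftarrow>Xs. walk_weight w (r # f X) + walk_weight w (r # rev (g X))"
  have tree: "edges_weight w T \<le> ?P"
  proof -
    \<comment> \<open>Two legs per tour, all hanging on the depot; together they rearrange the
      customers.\<close>
    define Ys where "Ys = concat (map (\<lambda>X. [f X, rev (g X)]) Xs)"
    have "mset (concat Ys) = mset (concat Xs)"
      unfolding Ys_def using fg
    proof (induction Xs)
      case (Cons X Xs)
      have "mset X = mset (f X) + mset (g X)" using Cons.prems by (metis list.set_intros(1) mset_append)
      then show ?case using Cons by simp
    qed simp
    then have Y: "distinct (concat Ys)" "set (concat Ys) = V"
      using Xs(1,2) mset_eq_imp_distinct_iff mset_eq_setD by blast+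
    then obtain T' where "spanning_tree U T'" "edges_weight w T' = (\<Sum>Y\<leftarrow>Ys. walk_weight w (r # Y))"
      using spanning_tree_of_paths[of r Ys] U by (auto simp: U_def)
    moreover have "(\<Sum>Y\<leftarrow>Ys. walk_weight w (r # Y)) = ?P"
      unfolding Ys_def by (induction Xs) auto
    ultimately show ?thesis using TM(1) by (auto simp: minimum_spanning_tree_def)
  qed
  have matching: "2 * edges_weight w M \<le> ?C"
    using Xs(1,2) U(3)
    by (intro minimum_perfect_matching_le[OF TM(2) rU(2) odd rU(1) XU]) (simp_all add: U_def)
  have cyc: "walk_weight w (r # us @ [r]) \<le> edges_weight w T + edges_weight w M"
    using euler_tour_shortcut_le[OF fin TM(3,4) rU(1) us(3)] .
  \<comment> \<open>The sum of distances does not depend on the order of the customers.\<close>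
  have "mset us = mset (concat Xs)"
    using us(1,2) Xs(1,2) U by (intro iffD1[OF set_eq_iff_mset_eq_distinct]) (auto simp: U_def)
  then have "(\<Sum>u\<leftarrow>us. w r u) = (\<Sum>x\<leftarrow>concat Xs. w r x)"
    by (metis mset_map sum_mset_sum_list)
  also have "\<dots> = (\<Sum>X\<leftarrow>Xs. \<Sum>x\<leftarrow>X. w r x)" by (induction Xs) auto
  finally have dist: "(\<Sum>u\<leftarrow>us. w r u) = (\<Sum>X\<leftarrow>Xs. \<Sum>x\<leftarrow>X. w r x)" .
  have "real k * agitp_cost r w k us \<le>
      (real k - 1) * walk_weight w (r # us @ [r]) + 2 * (\<Sum>u\<leftarrow>us. w r u)"
    using k us(2) rU sym refl0 by (intro agitp_cost_le_average) auto
  also have "\<dots> \<le> (real k - 1) * (?P + ?C / 2) + 2 * (\<Sum>X\<leftarrow>Xs. \<Sum>x\<leftarrow>X. w r x)"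
    unfolding dist using k cyc tree matching by (intro add_right_mono mult_left_mono) auto
  also have "\<dots> = (\<Sum>X\<leftarrow>Xs. (real k - 1) * (walk_weight w (r # f X) + walk_weight w (r # rev (g X))
       + walk_weight w (r # X @ [r]) / 2) + 2 * (\<Sum>x\<leftarrow>X. w r x))"
    by (induction Xs) (auto simp: algebra_simps add_divide_distrib)
  also have "\<dots> \<le> (\<Sum>X\<leftarrow>Xs. \<rho> * real k * walk_weight w (r # X @ [r]))"
    using fg by (intro sum_list_mono) auto
  also have "\<dots> = real k * (\<rho> * ?C)" by (simp add: sum_list_const_mult mult_ac)
  finally show ?thesis using k by simp
qed

section \<open>Unit customers served by a feasible solution\<close>

lemma subseq_remdups: "subseq (remdups xs) xs"
  by (induction xs) auto

lemma cvrp_instance_semimetric: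
  "cvrp_instance V v0 w d \<Longrightarrow> semimetric (insert v0 V) w"
  unfolding cvrp_instance_def semimetric_def by blast

lemma semimetric_unit_weight:
  "semimetric (insert v0 V) w \<Longrightarrow> semimetric (insert (v0, 0) (unit_customers V d)) (unit_weight w)"
proof -
  assume "semimetric (insert v0 V) w"
  then interpret semimetric "insert v0 V" w .
  have fst: "fst x \<in> insert v0 V" if "x \<in> insert (v0, 0) (unit_customers V d)" for x
    using that by (auto simp: unit_customers_def)
  show ?thesis
    unfolding unit_weight_def
    by unfold_locales (erule fst[THEN refl0], erule (1) nonneg[OF fst fst],
      erule (1) sym[OF fst fst], erule (2) tri[OF fst fst fst])
qed

text \<open>The offset \<open>s v\<close> stands for the units of \<open>v\<close> delivered by
  earlier tours; numbering the copies from there keeps the tours disjoint.\<close>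

lemma unit_tour:
  fixes V :: "'v set"
  assumes w: "semimetric (insert v0 V) w" and V: "finite V" "v0 \<notin> V"
    and t: "is_tour V v0 k (p, a)"
  shows "\<exists>X. distinct X \<and> set X = (SIGMA v:V. {s v..<s v + a v}) \<and> length X \<le> k \<and>
    walk_weight (unit_weight w) ((v0, 0) # X @ [(v0, 0)]) \<le> walk_weight w p"
proof -
  interpret semimetric "insert v0 V" w by (rule w)
  have p: "p \<noteq> []" "hd p = v0" "last p = v0" "set p \<subseteq> insert v0 V"
    "\<And>v. v \<in> V \<Longrightarrow> 0 < a v \<Longrightarrow> v \<in> set p" "(\<Sum>v\<in>V. a v) \<le> k"
    using t by (auto simp: is_tour_def)
  \<comment> \<open>One visit to each customer on the walk, without the depot.\<close>
  define vs where "vs = filter (\<lambda>v. v \<in> V) (remdups p)"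
  have vs: "distinct vs" "set vs = set p \<inter> V" by (auto simp: vs_def)
  have "subseq vs p"
    unfolding vs_def using subseq_filter_left subseq_remdups subseq_order.trans by blast
  define X where "X = concat (map (\<lambda>v. map (Pair v) [s v..<s v + a v]) vs)"
  have "set X = (SIGMA v:set vs. {s v..<s v + a v})" by (auto simp: X_def)
  \<comment> \<open>A customer off the walk receives nothing, so its interval is empty.\<close>
  also have "\<dots> = (SIGMA v:V. {s v..<s v + a v})"
    using p(5) vs(2) by fastforce
  finally have X: "set X = (SIGMA v:V. {s v..<s v + a v})" .
  have dX: "distinct X"
    unfolding X_def using vs(1) by (induction vs) (auto simp: distinct_map inj_on_def)
  have "length X = (\<Sum>v\<leftarrow>vs. a v)"
    by (simp add: X_def length_concat comp_def)
  also have "\<dots> = (\<Sum>v\<in>set vs. a v)"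
    using vs(1) by (simp add: sum_list_distinct_conv_sum_set)
  also have "\<dots> \<le> (\<Sum>v\<in>V. a v)"
    using V(1) vs(2) by (intro sum_mono2) auto
  also have "\<dots> \<le> k" by (rule p(6))
  finally have len: "length X \<le> k" .
  have "map fst X = concat (map (\<lambda>v. replicate (a v) v) vs)"
    unfolding X_def by (induction vs) (auto simp: map_replicate_const comp_def)
  then have "walk_weight (unit_weight w) ((v0, 0) # X @ [(v0, 0)]) =
      walk_weight w (v0 # concat (map (\<lambda>v. replicate (a v) v) vs) @ [v0])"
    using walk_weight_map[of w fst "(v0, 0) # X @ [(v0, 0)]"]
    by (simp add: unit_weight_def[abs_def])
  also have "\<dots> \<le> walk_weight w (v0 # vs @ [v0])"
    using vs(2) by (intro walk_weight_replicate_le) auto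
  also have "\<dots> \<le> walk_weight w (v0 # p @ [v0])"
    using \<open>subseq vs p\<close> p by (intro walk_weight_shortcut) auto
  also have "\<dots> = walk_weight w p"
    using p refl0[of v0] by (simp add: walk_weight_Cons walk_weight_append)
  finally show ?thesis using X dX len by blast
qed

lemma unit_tours:
  fixes V :: "'v set"
  assumes w: "semimetric (insert v0 V) w" and V: "finite V" "v0 \<notin> V"
    and S: "\<forall>t \<in> set S. is_tour V v0 k t"
  shows "\<exists>Xs. distinct (concat Xs) \<and> set (concat Xs) = (SIGMA v:V. {s v..<s v + (\<Sum>(p, a)\<leftarrow>S. a v)}) \<and>
    (\<forall>X\<in>set Xs. length X \<le> k) \<and>
    (\<Sum>X\<leftarrow>Xs. walk_weight (unit_weight w) ((v0, 0) # X @ [(v0, 0)])) \<le> solution_cost w S"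
  using S
proof (induction S arbitrary: s)
  case Nil
  show ?case by (intro exI[of _ "[]"]) (auto simp: solution_cost_def)
next
  case (Cons t S)
  obtain p a where t: "t = (p, a)" by (cases t)
  obtain X where X: "distinct X" "set X = (SIGMA v:V. {s v..<s v + a v})" "length X \<le> k"
    "walk_weight (unit_weight w) ((v0, 0) # X @ [(v0, 0)]) \<le> walk_weight w p"
    using unit_tour[OF w V, of k p a s] Cons.prems t by auto
  obtain Xs where Xs: "distinct (concat Xs)"
    "set (concat Xs) = (SIGMA v:V. {s v + a v..<s v + a v + (\<Sum>(p, a)\<leftarrow>S. a v)})"
    "\<forall>X\<in>set Xs. length X \<le> k"
    "(\<Sum>X\<leftarrow>Xs. walk_weight (unit_weight w) ((v0, 0) # X @ [(v0, 0)])) \<le> solution_cost w S"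
    using Cons.IH[of "\<lambda>v. s v + a v"] Cons.prems by auto
  have "set X \<inter> set (concat Xs) = {}" unfolding X(2) Xs(2) by auto
  then have "distinct (concat (X # Xs))" using X(1) Xs(1) by simp
  moreover have "set (concat (X # Xs)) = set X \<union> set (concat Xs)" by simp
  then have "set (concat (X # Xs)) = (SIGMA v:V. {s v..<s v + (\<Sum>(p, a)\<leftarrow>t # S. a v)})"
    unfolding X(2) Xs(2) t by auto
  moreover have "\<forall>X'\<in>set (X # Xs). length X' \<le> k" using X(3) Xs(3) by simp
  moreover have "(\<Sum>X\<leftarrow>X # Xs. walk_weight (unit_weight w) ((v0, 0) # X @ [(v0, 0)]))
      \<le> solution_cost w (t # S)"
    using X(4) Xs(4) by (simp add: solution_cost_def t)
  ultimately show ?case by blast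
qed

lemma feasible_solution_unit_tours:
  assumes "cvrp_instance V v0 w d" "feasible_solution V v0 d k S"
  obtains Xs where "distinct (concat Xs)" "set (concat Xs) = unit_customers V d"
    "\<And>X. X \<in> set Xs \<Longrightarrow> length X \<le> k"
    "(\<Sum>X\<leftarrow>Xs. walk_weight (unit_weight w) ((v0, 0) # X @ [(v0, 0)])) \<le> solution_cost w S"
proof -
  have V: "finite V" "v0 \<notin> V" and S: "\<forall>t\<in>set S. is_tour V v0 k t"
    using assms by (auto simp: cvrp_instance_def feasible_solution_def)
  \<comment> \<open>From offset \<open>0\<close>, the copies handed out are all of them because
    demands are met exactly.\<close>
  have *: "(SIGMA v:V. {0..<0 + (\<Sum>(p, a)\<leftarrow>S. a v)}) = unit_customers V d"
    using assms(2) unfolding feasible_solution_def unit_customers_def by (intro Sigma_cong) auto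
  from unit_tours[OF cvrp_instance_semimetric[OF assms(1)] V S, of "\<lambda>_. 0"]
  show thesis unfolding * using that by blast
qed

text \<open>One round trip per unit of demand. The infimum in \<open>opt_cost\<close> thus ranges
  over a nonempty set.\<close>

lemma feasible_solution_exists:
  assumes "finite V" "k > 0"
  shows "\<exists>S. feasible_solution V v0 d k S"
proof -
  obtain vs where vs: "set vs = V" "distinct vs" using assms(1) finite_distinct_list by blast
  define tour where "tour v = ([v0, v, v0], \<lambda>u. if u = v then 1 else 0 :: nat)" for v
  define S where "S = concat (map (\<lambda>v. replicate (d v) (tour v)) vs)"
  have "is_tour V v0 k t" if "t \<in> set S" for t
    using that assms vs(1) by (auto simp: S_def tour_def is_tour_def split: if_splits)
  moreover have "(\<Sum>(p, a)\<leftarrow>S. a u) = (if u \<in> V then d u else 0)" for u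
    unfolding S_def vs(1)[symmetric] using vs(2)
    by (induction vs) (auto simp: tour_def sum_list_replicate)
  ultimately have "feasible_solution V v0 d k S" by (simp add: feasible_solution_def)
  then show ?thesis ..
qed

lemma le_opt_cost:
  assumes "finite V" "k > 0" "\<rho> > 0"
    and "\<And>S. feasible_solution V v0 d k S \<Longrightarrow> x \<le> \<rho> * solution_cost w S"
  shows "x \<le> \<rho> * opt_cost V v0 w d k"
proof -
  have "x / \<rho> \<le> opt_cost V v0 w d k"
    unfolding opt_cost_def using feasible_solution_exists[OF assms(1,2)] assms(3,4)
    by (intro cINF_greatest) (auto simp: divide_le_eq mult.commute)
  then show ?thesis using assms(3) by (simp add: divide_le_eq mult.commute)
qed

theorem theorem5:
  fixes k l :: nat and \<rho> :: real
  assumes "k \<ge> 3"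
    and "l = nat \<lceil>(sqrt (2 * real k - 1) - 1) / 2\<rceil>"
    and "\<rho> = 5 / 2 - (2 * (real l)\<^sup>2 + real k + real l - 1) / (2 * real k * real l)"
  shows "(\<forall>(V :: 'v set) v0 w d us.
            cvrp_instance V v0 w d \<and> (\<forall>v\<in>V. d v = 1) \<and> christofides_cycle V v0 w us \<longrightarrow>
            agitp_cost v0 w k us \<le> \<rho> * opt_cost V v0 w d k) \<and>
         (\<forall>(V :: 'v set) v0 w d us.
            cvrp_instance V v0 w d \<and>
            christofides_cycle (unit_customers V d) (v0, 0) (unit_weight w) us \<longrightarrow>
            agitp_cost (v0, 0) (unit_weight w) k us \<le> \<rho> * opt_cost V v0 w d k) \<and>
         \<rho> < 5 / 2 - sqrt (2 / real k)"
proof (intro conjI allI impI; (elim conjE)?)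
  note param = ratio_parameter[OF assms(1,2)]
  note ratio = ratio_bounds[OF assms(1) param(1,2) assms(3)]
  show "\<rho> < 5 / 2 - sqrt (2 / real k)" by (rule ratio(2))
  fix V :: "'v set" and v0 w d
  assume inst: "cvrp_instance V v0 w d"
  then have V: "finite V" "v0 \<notin> V" by (auto simp: cvrp_instance_def)
  note metric = cvrp_instance_semimetric[OF inst]
  show "agitp_cost v0 w k us \<le> \<rho> * opt_cost V v0 w d k"
    if unit: "\<forall>v\<in>V. d v = 1" and H: "christofides_cycle V v0 w us" for us
  proof (rule le_opt_cost[OF V(1) _ ratio(1)])
    fix S assume "feasible_solution V v0 d k S"
    from feasible_solution_unit_tours[OF inst this] obtain Xs where Xs:
      "distinct (concat Xs)" "set (concat Xs) = unit_customers V d"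
      "\<And>X. X \<in> set Xs \<Longrightarrow> length X \<le> k"
      "(\<Sum>X\<leftarrow>Xs. walk_weight (unit_weight w) ((v0, 0) # X @ [(v0, 0)])) \<le> solution_cost w S"
      by blast
    define Ys where "Ys = map (map fst) Xs"
    \<comment> \<open>Each customer has the single copy \<open>(v, 0)\<close>, so \<open>fst\<close>
      is injective on the copies and carries the tours back to \<open>V\<close>.\<close>
    have units: "unit_customers V d = V \<times> {0}" using unit by (auto simp: unit_customers_def)
    have Ys: "concat Ys = map fst (concat Xs)" by (simp add: Ys_def map_concat)
    have "distinct (concat Ys)" "set (concat Ys) = V"
      unfolding Ys using Xs(1) by (auto simp: distinct_map inj_on_def Xs(2) units simp del: set_concat)
    moreover have "length Y \<le> k" if "Y \<in> set Ys" for Y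
      using that Xs(3) by (auto simp: Ys_def)
    ultimately have "agitp_cost v0 w k us \<le> \<rho> * (\<Sum>Y\<leftarrow>Ys. walk_weight w (v0 # Y @ [v0]))"
      using H by (intro agitp_cost_le_partition[OF assms metric V]) auto
    also have "(\<Sum>Y\<leftarrow>Ys. walk_weight w (v0 # Y @ [v0])) =
        (\<Sum>X\<leftarrow>Xs. walk_weight (unit_weight w) ((v0, 0) # X @ [(v0, 0)]))"
    proof -
      have "walk_weight w (v0 # map fst X @ [v0]) =
          walk_weight (unit_weight w) ((v0, 0) # X @ [(v0, 0)])" for X :: "('v \<times> nat) list"
        using walk_weight_map[of w fst "(v0, 0) # X @ [(v0, 0)]"]
        by (simp add: unit_weight_def[abs_def])
      then show ?thesis by (simp add: Ys_def comp_def)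
    qed
    also have "\<rho> * \<dots> \<le> \<rho> * solution_cost w S"
      using Xs(4) ratio(1) by (intro mult_left_mono) auto
    finally show "agitp_cost v0 w k us \<le> \<rho> * solution_cost w S" .
  qed (use assms(1) in auto)
  show "agitp_cost (v0, 0) (unit_weight w) k us \<le> \<rho> * opt_cost V v0 w d k"
    if H: "christofides_cycle (unit_customers V d) (v0, 0) (unit_weight w) us" for us
  proof (rule le_opt_cost[OF V(1) _ ratio(1)])
    fix S assume "feasible_solution V v0 d k S"
    from feasible_solution_unit_tours[OF inst this] obtain Xs where Xs:
      "distinct (concat Xs)" "set (concat Xs) = unit_customers V d"
      "\<And>X. X \<in> set Xs \<Longrightarrow> length X \<le> k"
      "(\<Sum>X\<leftarrow>Xs. walk_weight (unit_weight w) ((v0, 0) # X @ [(v0, 0)])) \<le> solution_cost w S"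
      by blast
    \<comment> \<open>The cycle already lives on the unit copies, so the tours are used without
      projection.\<close>
    have "agitp_cost (v0, 0) (unit_weight w) k us \<le>
        \<rho> * (\<Sum>X\<leftarrow>Xs. walk_weight (unit_weight w) ((v0, 0) # X @ [(v0, 0)]))"
      using V H Xs by (intro agitp_cost_le_partition[OF assms semimetric_unit_weight[OF metric]])
        (auto simp: unit_customers_def simp del: set_concat)
    also have "\<dots> \<le> \<rho> * solution_cost w S"
      using Xs(4) ratio(1) by (intro mult_left_mono) auto
    finally show "agitp_cost (v0, 0) (unit_weight w) k us \<le> \<rho> * solution_cost w S" .
  qed (use assms(1) in auto)
qed

end
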